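(* Let $c$ and $h$ be nonnegative integers with $c$ odd. If $h$ is sufficiently large, then $\nu_2(S(c2^{h+1}+L,c2^h+L))$ is constant for all integers $L$ with $0\le L<2^h$; in fact, $$\nu_2(S(c2^{h+1}+L,c2^h+L))=2\sigma_2(c)-\sigma_2(3c)\quad\text{for all } 0\le L<2^h.$$ The bound $2^{h-1}\ge\nu_2\left(\binom{3c}{c}\right)$ on $h$ suffices.
   Context: $S(n,k)$ is the Stirling number of the second kind; $\sigma_2(m)$ is the sum of the base $2$ digits of $m\ge 0$; $\nu_2$ is the $2$-adic valuation. *)

theory Defs
  imports Complex_Main "HOL-Computational_Algebra.Primes" "HOL-Combinatorics.Stirling"
begin

text \<open>The sum of the base \<open>2\<close> digits.\<close>

fun sigma2 :: "nat \<Rightarrow> nat" where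
  "sigma2 m = (if m = 0 then 0 else m mod 2 + sigma2 (m div 2))"

text \<open>The defining equation loops as an unconditional rewrite rule.\<close>

declare sigma2.simps [simp del]

text \<open>
  \<open>multiplicity 2 0 = 0\<close>, so this agrees with the \<open>2\<close>-adic valuation on nonzero arguments only.
\<close>

abbreviation nu2 :: "nat \<Rightarrow> nat" where
  "nu2 n \<equiv> multiplicity 2 n"

end

theory Submission
  imports Defs "HOL-Computational_Algebra.Formal_Power_Series" "HOL-Library.FuncSet"
begin

text \<open>
  Write \<open>k = N + L\<close>, \<open>n = k + N\<close> with \<open>N = c2\<^sup>h\<close>. Then \<open>S(n,k)\<close> is \<open>(n-1)!/(k-1)!\<close> times the coefficient of
  \<open>t\<^sup>N\<close> in \<open>(t / log (1+t))\<^sup>n\<close>, and expanding this power of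
  \<open>log (1+t) / t = 1 - t/2 + t\<^sup>2/3 - ...\<close> gives a sum over the partitions of \<open>N\<close> with \<open>u\<^sub>i\<close> parts equal to \<open>i\<close>,
  whose terms are, up to sign, \<open>(n-1+w)! / ((k-1)! \<Prod> u\<^sub>i! (i+1)^u\<^sub>i)\<close> with \<open>w = \<Sum> u\<^sub>i\<close>.
  By Legendre's formula the valuation of such a term is
  \<open>\<Sum> (\<sigma>\<^sub>2 u\<^sub>i + u\<^sub>i (i - \<nu>\<^sub>2 (i+1))) + \<sigma>\<^sub>2 (k-1) - \<sigma>\<^sub>2 (n-1+w)\<close>.
  The partition into ones yields exactly \<open>2\<sigma>\<^sub>2 c - \<sigma>\<^sub>2 (3c)\<close>. With \<open>d = N - w\<close>, every other term has a larger
  valuation: for \<open>d < 2\<^sup>h\<close> by bounding carries of binary additions relative to that leading term, and for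
  \<open>d \<ge> 2\<^sup>h\<close> because the valuation is at least \<open>d/2 \<ge> 2^(h-1)\<close>, with equality excluded.
\<close>

section \<open>Stirling numbers as a sum over partitions\<close>

unbundle fps_syntax

text \<open>The series of \<open>log (1+t) / t\<close>.\<close>

definition logq :: "rat fps" where
  "logq = Abs_fps (\<lambda>i. (-1) ^ i / of_nat (Suc i))"

lemma logq_nth: "logq $ i = (-1) ^ i / of_nat (Suc i)"
  by (simp add: logq_def)

text \<open>The second factor is the derivative of \<open>fps_X * logq\<close>, the series of log
  (1+t), so it is 1/(1+t).\<close>

lemma logq_ODE: "(1 + fps_X) * (logq + fps_X * fps_deriv logq) = 1"
proof -
  have "logq + fps_X * fps_deriv logq = Abs_fps (\<lambda>j. (-1) ^ j)"
  proof (rule fps_ext)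
    show "(logq + fps_X * fps_deriv logq) $ j = Abs_fps (\<lambda>j. (-1) ^ j) $ j" for j
      by (cases j) (simp_all add: logq_nth divide_simps del: of_nat_Suc, simp add: algebra_simps)
  qed
  moreover have "(1 + fps_X) * Abs_fps (\<lambda>j. (-1) ^ j) = (1 :: rat fps)"
  proof (rule fps_ext)
    show "((1 + fps_X) * Abs_fps (\<lambda>j. (-1) ^ j)) $ j = (1 :: rat fps) $ j" for j
      by (cases j) (simp_all add: distrib_right)
  qed
  ultimately show ?thesis by simp
qed

text \<open>Multiplying the differential equation of \<open>logq\<close> by \<open>g^2\<close>,
  where \<open>g = inverse logq\<close>, gives one for g, and the chain rule carries it to powers.
  It links two consecutive powers, so its coefficients yield a recurrence in p.\<close>

lemma logq_inverse_power_ODE: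
  "fps_X * (1 + fps_X) * fps_deriv (inverse logq ^ p)
     = of_nat p * (inverse logq ^ p * (1 + fps_X) - inverse logq ^ Suc p)"
proof (cases p)
  case (Suc m)
  define g where "g = inverse logq"
  have l0: "logq $ 0 \<noteq> 0" by (simp add: logq_nth)
  have g1: "g * logq = 1" unfolding g_def using l0 by (rule inverse_mult_eq_1)
  have "fps_X * (1 + fps_X) * fps_deriv g = - (g^2 * (fps_X * (1 + fps_X) * fps_deriv logq))"
    using l0 by (simp add: g_def fps_inverse_deriv algebra_simps)
  also have "fps_X * (1 + fps_X) * fps_deriv logq = 1 - (1 + fps_X) * logq"
    using logq_ODE by (simp add: algebra_simps)
  also have "- (g^2 * (1 - (1 + fps_X) * logq)) = (g * logq) * g * (1 + fps_X) - g^2"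
    by (simp add: algebra_simps power2_eq_square)
  finally have *: "fps_X * (1 + fps_X) * fps_deriv g = g * (1 + fps_X) - g^2"
    by (simp add: g1)
  have "fps_X * (1 + fps_X) * fps_deriv (g ^ p) = of_nat p * g ^ m * (fps_X * (1 + fps_X) * fps_deriv g)"
    by (simp add: fps_deriv_power' Suc algebra_simps del: of_nat_Suc power_Suc)
  also have "\<dots> = of_nat p * (g ^ p * (1 + fps_X) - g ^ Suc p)"
    by (simp only: *) (simp add: Suc algebra_simps power2_eq_square)
  finally show ?thesis by (simp add: g_def)
qed simp

text \<open>Multiplied by \<open>(p-1)! / (p-N-1)!\<close>, this becomes the recurrence of the Stirling numbers.\<close>

lemma logq_inverse_power_rec:
  "of_nat p * (inverse logq ^ Suc p) $ Suc N
     = (of_nat p - of_nat (Suc N)) * (inverse logq ^ p) $ Suc N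
       + (of_nat p - of_nat N) * (inverse logq ^ p) $ N"
proof -
  define G where "G = inverse logq ^ p"
  have "(fps_X * (1 + fps_X) * fps_deriv G) $ Suc N = of_nat (Suc N) * G $ Suc N + of_nat N * G $ N"
    by (cases N) (simp_all add: distrib_right mult.assoc)
  moreover have "(of_nat p * (G * (1 + fps_X) - inverse logq ^ Suc p)) $ Suc N
     = of_nat p * (G $ Suc N + G $ N - (inverse logq ^ Suc p) $ Suc N)"
    by (simp add: fps_of_nat[symmetric] distrib_left del: power_Suc)
  ultimately have "of_nat (Suc N) * G $ Suc N + of_nat N * G $ N
     = of_nat p * (G $ Suc N + G $ N - (inverse logq ^ Suc p) $ Suc N)"
    using logq_inverse_power_ODE[of p] by (simp only: G_def[symmetric])
  then show ?thesis
    by (simp only: G_def[symmetric]) (simp add: algebra_simps del: power_Suc)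
qed

text \<open>Both sides satisfy the Stirling recurrence, whose two terms are the instances
  \<open>(k, N - 1)\<close> and \<open>(k - 1, N)\<close>; hence the induction on
  \<open>k + N\<close>.\<close>

lemma Stirling_eq_logq_coeff:
  "of_nat (Stirling (Suc (k + N)) (Suc k)) = fact (k + N) / fact k * (inverse logq ^ Suc (k + N)) $ N"
proof (induction "k + N" arbitrary: k N)
  case 0
  then show ?case by (simp add: logq_nth)
next
  case (Suc p)
  show ?case
  proof (cases N)
    case 0
    then show ?thesis
      by (simp add: logq_nth fps_nth_power_0 del: power_Suc Stirling.simps)
  next
    case (Suc M)
    have p: "p = k + M" using Suc Suc.hyps by simp
    have 1: "of_nat (Stirling (Suc (k + M)) (Suc k)) = fact (k + M) / fact k * (inverse logq ^ Suc (k + M)) $ M"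
      using Suc.hyps(1)[OF p] .
    \<comment> \<open>For \<open>k = 0\<close> both sides vanish; otherwise the induction hypothesis
      applies to \<open>(k - 1, N)\<close>, which has the same sum p.\<close>
    have 2: "of_nat (Stirling (Suc (k + M)) k)
        = of_nat k * fact (k + M) / fact k * (inverse logq ^ Suc (k + M)) $ N"
    proof (cases k)
      case k: (Suc j)
      have "p = j + N" using p k Suc by simp
      from Suc.hyps(1)[OF this] show ?thesis
        using k Suc by (simp add: field_simps del: Stirling.simps power_Suc of_nat_Suc)
    qed simp
    have 3: "of_nat (Suc p) * (inverse logq ^ Suc (Suc p)) $ N
       = of_nat k * (inverse logq ^ Suc p) $ N + of_nat (Suc k) * (inverse logq ^ Suc p) $ M"
      using logq_inverse_power_rec[of "Suc p" M] p Suc by (simp add: algebra_simps del: power_Suc)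
    have "of_nat (Stirling (Suc (k + N)) (Suc k)) =
        of_nat (Suc k) * rat_of_nat (Stirling (Suc (k + M)) (Suc k)) + of_nat (Stirling (Suc (k + M)) k)"
      by (simp only: Suc add_Suc_right Stirling.simps of_nat_add of_nat_mult)
    also have "\<dots> = fact p / fact k * (of_nat (Suc p) * (inverse logq ^ Suc (Suc p)) $ N)"
      unfolding 3 unfolding 1 2 p by (simp add: field_simps del: power_Suc)
    also have "\<dots> = fact (k + N) / fact k * (inverse logq ^ Suc (k + N)) $ N"
      using p Suc by (simp add: mult_ac del: power_Suc)
    finally show ?thesis .
  qed
qed

section \<open>Multinomial expansion and negative powers of a series\<close>

text \<open>The multinomial theorem, peeling off one monomial at a time by the binomial theorem. The
  bound B keeps the index set finite, and as it may exceed w, one range serves all exponents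
  later.\<close>

lemma sum_monomials_power:
  fixes a :: "nat \<Rightarrow> 'a::field_char_0"
  assumes "finite I" "w \<le> B"
  shows "(\<Sum>i\<in>I. fps_const (a i) * fps_X ^ i) ^ w =
    (\<Sum>u | u \<in> I \<rightarrow>\<^sub>E {..B} \<and> sum u I = w.
       fps_const (fact w * (\<Prod>i\<in>I. a i ^ u i / fact (u i))) * fps_X ^ (\<Sum>i\<in>I. i * u i))"
  using assms
proof (induction I arbitrary: w rule: finite_induct)
  case empty
  then show ?case by (cases w) simp_all
next
  case (insert x I)
  define S where "S J w = {u. u \<in> J \<rightarrow>\<^sub>E {..B} \<and> sum u J = w}" for J :: "nat set" and w
  define c where "c J u = (\<Prod>i\<in>J. a i ^ u i / fact (u i))" for J :: "nat set" and u
  define e where "e J u = (\<Sum>i\<in>J. i * u i)" for J :: "nat set" and u :: "nat \<Rightarrow> nat"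
  define y where "y = (\<Sum>i\<in>I. fps_const (a i) * fps_X ^ i)"
  have fin: "finite (S I w)" for w
    unfolding S_def by (rule finite_subset[of _ "I \<rightarrow>\<^sub>E {..B}"]) (auto intro!: finite_PiE insert.hyps)
  have IH: "y ^ v = (\<Sum>u\<in>S I v. fps_const (fact v * c I u) * fps_X ^ e I u)" if "v \<le> B" for v
    using insert.IH[OF that] by (simp only: y_def S_def c_def e_def)
  have "sum (u(x := j)) I = sum u I" "c I (u(x := j)) = c I u" "e I (u(x := j)) = e I u" for u j
    unfolding c_def e_def using insert.hyps by (auto intro!: sum.cong prod.cong)
  moreover have "c (insert x I) v = a x ^ v x / fact (v x) * c I v" "e (insert x I) v = x * v x + e I v" for v
    using insert.hyps by (simp_all add: c_def e_def)
  ultimately have upd: "sum (u(x := j)) (insert x I) = j + sum u I"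
    "c (insert x I) (u(x := j)) = a x ^ j / fact j * c I u"
    "e (insert x I) (u(x := j)) = x * j + e I u" for u j
    using insert.hyps by simp_all
  have "(\<Sum>i\<in>insert x I. fps_const (a i) * fps_X ^ i) ^ w = (fps_const (a x) * fps_X ^ x + y) ^ w"
    using insert.hyps by (simp add: y_def)
  also have "\<dots> = (\<Sum>j\<le>w. of_nat (w choose j) * (fps_const (a x) * fps_X ^ x) ^ j * y ^ (w - j))"
    by (rule binomial_ring)
  also have "\<dots> = (\<Sum>j\<le>w. \<Sum>u\<in>S I (w - j).
      fps_const (fact w * c (insert x I) (u(x := j))) * fps_X ^ e (insert x I) (u(x := j)))"
  proof (rule sum.cong[OF refl])
    fix j assume "j \<in> {..w}"
    then have j: "j \<le> w" by simp
    have b: "of_nat (w choose j) = (fact w / (fact j * fact (w - j)) :: 'a)"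
      by (rule binomial_fact[OF j])
    have mono: "fps_const A * (fps_const C * fps_X ^ p) * (fps_const D * fps_X ^ q)
        = fps_const (A * C * D) * fps_X ^ (p + q)" for A C D :: 'a and p q
    proof -
      have "fps_const A * (fps_const C * fps_X ^ p) * (fps_const D * fps_X ^ q)
          = (fps_const A * fps_const C * fps_const D) * (fps_X ^ p * fps_X ^ q)"
        by (simp only: mult_ac)
      then show ?thesis by (simp only: fps_const_mult power_add)
    qed
    have pow: "(fps_const (a x) * fps_X ^ x) ^ j = fps_const (a x ^ j) * fps_X ^ (x * j)"
      by (simp only: power_mult_distrib power_mult fps_const_power)
    have "w - j \<le> B" using insert.prems by simp
    show "of_nat (w choose j) * (fps_const (a x) * fps_X ^ x) ^ j * y ^ (w - j) =
      (\<Sum>u\<in>S I (w - j). fps_const (fact w * c (insert x I) (u(x := j))) * fps_X ^ e (insert x I) (u(x := j)))"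
      unfolding pow IH[OF \<open>w - j \<le> B\<close>] fps_of_nat[symmetric] b sum_distrib_left mono upd
      by (rule sum.cong) simp_all
  qed
  also have "\<dots> = (\<Sum>(j, u)\<in>(SIGMA j:{..w}. S I (w - j)).
      fps_const (fact w * c (insert x I) (u(x := j))) * fps_X ^ e (insert x I) (u(x := j)))"
    by (rule sum.Sigma) (auto simp: fin)
  also have "\<dots> = (\<Sum>u\<in>S (insert x I) w. fps_const (fact w * c (insert x I) u) * fps_X ^ e (insert x I) u)"
  \<comment> \<open>Resetting x to \<open>undefined\<close> makes the remaining function extensional
    on I again.\<close>
  proof (rule sum.reindex_bij_witness[where j = "\<lambda>(j, u). u(x := j)" and i = "\<lambda>v. (v x, v(x := undefined))"])
    fix p assume "p \<in> (SIGMA j:{..w}. S I (w - j))"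
    then obtain j u where p: "p = (j, u)" "j \<le> w" "u \<in> I \<rightarrow>\<^sub>E {..B}" "sum u I = w - j"
      by (auto simp: S_def)
    have ux: "u x = undefined" using p(3) insert.hyps by (auto simp: PiE_def extensional_def)
    show "(\<lambda>v. (v x, v(x := undefined))) ((\<lambda>(j, u). u(x := j)) p) = p"
      using p(1) ux by (auto simp: fun_eq_iff)
    show "(\<lambda>(j, u). u(x := j)) p \<in> S (insert x I) w"
      using p insert.prems insert.hyps upd(1)[of u j] by (auto simp: S_def PiE_iff extensional_def)
    show "fps_const (fact w * c (insert x I) ((\<lambda>(j, u). u(x := j)) p)) * fps_X ^ e (insert x I) ((\<lambda>(j, u). u(x := j)) p)
      = (case p of (j, u) \<Rightarrow> fps_const (fact w * c (insert x I) (u(x := j))) * fps_X ^ e (insert x I) (u(x := j)))"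
      by (simp add: p(1))
  next
    fix v assume v: "v \<in> S (insert x I) w"
    show "(\<lambda>(j, u). u(x := j)) (v x, v(x := undefined)) = v" by simp
    have "sum (v(x := undefined)) I = sum v I"
      using insert.hyps by (auto intro!: sum.cong)
    then show "(v x, v(x := undefined)) \<in> (SIGMA j:{..w}. S I (w - j))"
      using v insert.hyps by (auto simp: S_def PiE_iff extensional_def)
  qed
  finally show ?case by (simp only: S_def c_def e_def)
qed

lemma fps_power_nth_cong:
  fixes f g :: "'a::comm_semiring_1 fps"
  assumes "\<And>j. j \<le> N \<Longrightarrow> f $ j = g $ j" "j \<le> N"
  shows "(f ^ w) $ j = (g ^ w) $ j"
  using assms(2)
proof (induction w arbitrary: j)
  case (Suc w)
  then show ?case by (simp add: fps_mult_nth assms(1))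
qed simp

text \<open>With \<open>y = 1 - f\<close>, which has no constant term, compose the negative binomial
  series of 1/(1-t)^(p+1) with y. Powers of y beyond N do not reach degree N.\<close>

lemma fps_inverse_power_nth:
  fixes f :: "'a::field_char_0 fps"
  assumes "f $ 0 = 1"
  shows "(inverse f ^ Suc p) $ N = (\<Sum>w\<le>N. of_nat ((p + w) choose w) * ((1 - f) ^ w) $ N)"
proof -
  define y where "y = 1 - f"
  have y0: "y $ 0 = 0" using assms by (simp add: y_def)
  have "inverse ((1 - fps_const 1 * fps_X :: 'a fps) ^ Suc p) = Abs_fps (\<lambda>k. of_nat ((p + k) choose k))"
    by (subst one_minus_const_fps_X_neg_power') simp_all
  then have e: "inverse (1 - fps_X :: 'a fps) ^ Suc p = Abs_fps (\<lambda>k. of_nat ((p + k) choose k))"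
    by (simp add: fps_inverse_power del: power_Suc)
  have "inverse f ^ Suc p = inverse ((1 - fps_X) oo y) ^ Suc p"
    using y0 by (simp add: fps_compose_sub_distrib y_def)
  also have "\<dots> = (inverse (1 - fps_X) ^ Suc p) oo y"
    using y0 by (simp only: fps_compose_power[OF y0, symmetric]) (subst fps_inverse_compose, simp_all)
  finally show ?thesis
    by (simp only: e fps_compose_nth y_def fps_nth_Abs_fps atLeast0AtMost)
qed

text \<open>The index w of the negative binomial series becomes the number of parts. The w! of the
  multinomial coefficient cancels the one in the binomial coefficient, leaving (k+N+w)!.\<close>

proposition Stirling_expansion:
  "of_nat (Stirling (Suc (k + N)) (Suc k)) =
    (\<Sum>u | u \<in> {1..N} \<rightarrow>\<^sub>E {..N} \<and> (\<Sum>i\<in>{1..N}. i * u i) = N.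
      fact (k + N + sum u {1..N}) / fact k * (\<Prod>i\<in>{1..N}. ((-1) ^ Suc i / of_nat (Suc i)) ^ u i / fact (u i)) :: rat)"
proof -
  define a :: "nat \<Rightarrow> rat" where "a = (\<lambda>i. (-1) ^ Suc i / of_nat (Suc i))"
  define c where "c u = (\<Prod>i\<in>{1..N}. a i ^ u i / fact (u i))" for u
  define W where "W = {u. u \<in> {1..N} \<rightarrow>\<^sub>E {..N} \<and> (\<Sum>i\<in>{1..N}. i * u i) = N}"
  define S where "S w = {u. u \<in> {1..N} \<rightarrow>\<^sub>E {..N} \<and> sum u {1..N} = w}" for w
  have finP: "finite ({1..N} \<rightarrow>\<^sub>E {..N})" by (intro finite_PiE) auto
  have fin: "finite W" "finite (S w)" for w
    unfolding W_def S_def by (rule finite_subset[OF _ finP], blast)+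
  have le: "sum u {1..N} \<le> N" if "u \<in> W" for u
  proof -
    have "sum u {1..N} \<le> (\<Sum>i\<in>{1..N}. i * u i)" by (intro sum_mono) simp
    then show ?thesis using that by (simp add: W_def)
  qed
  have pow: "((1 - logq) ^ w) $ N = fact w * (\<Sum>u\<in>{u\<in>W. sum u {1..N} = w}. c u)" if "w \<le> N" for w
  proof -
    \<comment> \<open>The coefficient at N sees only degrees up to N, so \<open>1 - logq\<close>,
      which has no constant term, may be truncated to a polynomial.\<close>
    have "((1 - logq) ^ w) $ N = ((\<Sum>i\<in>{1..N}. fps_const (a i) * fps_X ^ i) ^ w) $ N"
    proof (rule fps_power_nth_cong[OF _ order_refl])
      fix j assume "j \<le> N"
      then show "(1 - logq) $ j = (\<Sum>i\<in>{1..N}. fps_const (a i) * fps_X ^ i) $ j"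
        by (cases "j = 0") (auto simp: fps_sum_nth fps_X_power_iff logq_nth a_def if_distrib cong: if_cong)
    qed
    also have "\<dots> = (\<Sum>u\<in>S w. if (\<Sum>i\<in>{1..N}. i * u i) = N then fact w * c u else 0)"
      unfolding sum_monomials_power[OF finite_atLeastAtMost that] S_def[symmetric]
      by (auto simp: fps_sum_nth fps_X_power_iff c_def intro!: sum.cong)
    also have "\<dots> = (\<Sum>u\<in>{u\<in>S w. (\<Sum>i\<in>{1..N}. i * u i) = N}. fact w * c u)"
      by (rule sum.inter_filter[symmetric, OF fin(2)])
    also have "{u\<in>S w. (\<Sum>i\<in>{1..N}. i * u i) = N} = {u\<in>W. sum u {1..N} = w}"
      by (auto simp: S_def W_def)
    finally show ?thesis by (simp add: sum_distrib_left)
  qed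
  have "of_nat (Stirling (Suc (k + N)) (Suc k)) =
      fact (k + N) / fact k * (\<Sum>w\<le>N. of_nat ((k + N + w) choose w) * (fact w * (\<Sum>u\<in>{u\<in>W. sum u {1..N} = w}. c u)))"
    unfolding Stirling_eq_logq_coeff by (subst fps_inverse_power_nth) (simp_all add: logq_nth pow)
  also have "\<dots> = (\<Sum>w\<le>N. \<Sum>u\<in>{u\<in>W. sum u {1..N} = w}. fact (k + N + sum u {1..N}) / fact k * c u)"
    unfolding sum_distrib_left
    by (intro sum.cong refl) (auto simp: binomial_fact[of _ "k + N + _"])
  also have "\<dots> = (\<Sum>u\<in>W. fact (k + N + sum u {1..N}) / fact k * c u)"
    by (rule sum.group) (use fin le in auto)
  finally show ?thesis by (simp only: W_def c_def a_def)
qed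

section \<open>Binary digit sums\<close>

lemma sigma2_0 [simp]: "sigma2 0 = 0"
  by (simp add: sigma2.simps)

lemma sigma2_double [simp]: "sigma2 (2 * m) = sigma2 m"
  by (simp add: sigma2.simps[of "2 * m"])

lemma sigma2_Suc_double [simp]: "sigma2 (Suc (2 * m)) = Suc (sigma2 m)"
  by (simp add: sigma2.simps[of "Suc (2 * m)"])

lemma sigma2_mult_power2 [simp]: "sigma2 (m * 2 ^ h) = sigma2 m"
  by (induction h) (simp_all add: mult.left_commute[of m 2])

lemma sigma2_1 [simp]: "sigma2 (Suc 0) = 1"
  using sigma2_Suc_double[of 0] by simp

lemma nu2_double: "m > 0 \<Longrightarrow> nu2 (2 * m) = Suc (nu2 m)"
  by (rule multiplicity_times_same) auto

lemma nu2_odd: "odd m \<Longrightarrow> nu2 m = 0"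
  by (rule not_dvd_imp_multiplicity_0)

text \<open>Adding 1 clears the trailing ones of m, \<open>nu2 (Suc m)\<close> in number, and sets
  the zero above them.\<close>

lemma sigma2_Suc: "sigma2 (Suc m) + nu2 (Suc m) = Suc (sigma2 m)"
proof (induction m rule: less_induct)
  case (less m)
  show ?case
  proof (cases "even m")
    case True
    then obtain j where "m = 2 * j" by (rule evenE)
    then show ?thesis by (simp add: nu2_odd)
  next
    case False
    then obtain j where j: "m = Suc (2 * j)" by (metis oddE Suc_eq_plus1)
    have "Suc m = 2 * Suc j" using j by simp
    then have "sigma2 (Suc m) + nu2 (Suc m) = Suc (sigma2 (Suc j) + nu2 (Suc j))"
      by (simp only: sigma2_double nu2_double[OF zero_less_Suc])
    also have "\<dots> = Suc (Suc (sigma2 j))" using less.IH[of j] j by simp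
    finally show ?thesis by (simp add: j)
  qed
qed

lemma sigma2_Suc_le: "sigma2 (Suc m) \<le> Suc (sigma2 m)"
  using sigma2_Suc[of m] by simp

lemma sigma2_double_add:
  "sigma2 (2 * x + 2 * y) = sigma2 (x + y)"
  "sigma2 (Suc (2 * x + 2 * y)) = Suc (sigma2 (x + y))"
  "sigma2 (Suc (Suc (2 * x + 2 * y))) = sigma2 (Suc (x + y))"
  "sigma2 (Suc (Suc (Suc (2 * x + 2 * y)))) = Suc (sigma2 (Suc (x + y)))"
  using sigma2_double[of "x + y"] sigma2_Suc_double[of "x + y"] sigma2_double[of "Suc (x + y)"]
    sigma2_Suc_double[of "Suc (x + y)"] by (simp_all del: sigma2_double sigma2_Suc_double)

lemma sigma2_add_le: "sigma2 (a + b) \<le> sigma2 a + sigma2 b"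
proof (induction a arbitrary: b rule: less_induct)
  case (less a)
  show ?case
  proof (cases "a = 0")
    case False
    have IH: "sigma2 (a div 2 + b') \<le> sigma2 (a div 2) + sigma2 b'" for b'
      using less.IH[of "a div 2"] False by simp
    obtain x y where xy: "a = 2 * x \<or> a = Suc (2 * x)" "b = 2 * y \<or> b = Suc (2 * y)"
      by (metis evenE oddE Suc_eq_plus1)
    then have "x = a div 2" by auto
    with IH[of y] have "sigma2 (x + y) \<le> sigma2 x + sigma2 y" by simp
    with xy sigma2_Suc_le[of "x + y"] show ?thesis
      by (auto simp: sigma2_double_add)
  qed simp
qed

lemma sigma2_sum_le: "sigma2 (\<Sum>i\<in>A. f i) \<le> (\<Sum>i\<in>A. sigma2 (f i))"
proof (induction A rule: infinite_finite_induct)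
  case (insert x A)
  then show ?case using sigma2_add_le[of "f x" "sum f A"] by simp
qed simp_all

lemma sigma2_le: "sigma2 m \<le> m"
proof (induction m)
  case (Suc m)
  then show ?case using sigma2_Suc_le[of m] by simp
qed simp

text \<open>Long multiplication: the product is a sum of \<open>sigma2 m\<close> shifted copies of
  q.\<close>

lemma sigma2_mult_le: "sigma2 (q * m) \<le> sigma2 q * sigma2 m"
proof (induction m rule: less_induct)
  case (less m)
  show ?case
  proof (cases "even m")
    case True
    then obtain j where j: "m = 2 * j" by (rule evenE)
    have "q * m = 2 * (q * j)" using j by simp
    then show ?thesis using less.IH[of j] j by (cases "j = 0") (simp_all only: sigma2_double, simp_all)
  next
    case False
    then obtain j where j: "m = Suc (2 * j)" by (metis oddE Suc_eq_plus1)
    have "q * m = q + 2 * (q * j)" using j by simp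
    then have "sigma2 (q * m) \<le> sigma2 q + sigma2 (q * j)"
      using sigma2_add_le[of q "2 * (q * j)"] by simp
    then show ?thesis using less.IH[of j] j by simp
  qed
qed

lemma sigma2_mult_power2_add: "r < 2 ^ h \<Longrightarrow> sigma2 (q * 2 ^ h + r) = sigma2 q + sigma2 r"
proof (induction h arbitrary: r)
  case (Suc h)
  have IH: "sigma2 (q * 2 ^ h + r div 2) = sigma2 q + sigma2 (r div 2)"
    by (rule Suc.IH) (use Suc.prems in auto)
  show ?case
  proof (cases "even r")
    case True
    then obtain j where j: "r = 2 * j" by (rule evenE)
    have "q * 2 ^ Suc h + r = 2 * (q * 2 ^ h + j)" using j by simp
    then show ?thesis using IH j by (simp only: sigma2_double) simp
  next
    case False
    then obtain j where j: "r = Suc (2 * j)" by (metis oddE Suc_eq_plus1)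
    have "q * 2 ^ Suc h + r = Suc (2 * (q * 2 ^ h + j))" using j by simp
    then show ?thesis using IH j by (simp only: sigma2_Suc_double) simp
  qed
qed simp

text \<open>Legendre's formula for the prime 2, kept additive to avoid truncated
  subtraction.\<close>

lemma nu2_fact: "nu2 (fact m) + sigma2 m = m"
proof (induction m)
  case (Suc m)
  have "nu2 (fact (Suc m)) = nu2 (Suc m) + nu2 (fact m :: nat)"
    by (simp add: prime_elem_multiplicity_mult_distrib del: mult_Suc)
  then show ?case using Suc sigma2_Suc[of m] by simp
qed simp

section \<open>Bounds on carries\<close>

text \<open>The digit sum lost in adding a, b and an incoming 1 is the number of carries. The total
  has at most h+1 bits, so only the lowest h positions can emit one.\<close>

lemma sigma2_carry_in_bound:
  "a + b + 1 < 2 ^ Suc h \<Longrightarrow> sigma2 a + sigma2 b + 1 \<le> sigma2 (a + b + 1) + h"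
proof (induction h arbitrary: a b)
  case 0
  then show ?case by simp
next
  case (Suc h)
  have IH: "sigma2 x + sigma2 y + 1 \<le> sigma2 (x + y + 1) + h" if "x + y + 1 < 2 ^ Suc h" for x y
    using Suc.IH that .
  \<comment> \<open>Without an incoming carry, take 1 from x and let it serve as the carry.\<close>
  have IH': "sigma2 x + sigma2 y \<le> sigma2 (x + y) + h" if "x + y < 2 ^ Suc h" for x y
  proof (cases x)
    case (Suc z)
    then show ?thesis using IH[of z y] that sigma2_Suc_le[of z] by simp
  qed simp
  obtain x y where xy: "a = 2 * x \<or> a = Suc (2 * x)" "b = 2 * y \<or> b = Suc (2 * y)"
    by (metis evenE oddE Suc_eq_plus1)
  show ?case
    using xy IH[of x y] IH'[of x y] Suc.prems by (auto simp: sigma2_double_add)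
qed

text \<open>With \<open>d = Suc a\<close>, \<open>sigma2 d + nu2 d\<close> is
  \<open>sigma2 a + 1\<close>, so the claim bounds the carries in adding a, the difference and an
  incoming 1. Either all happens in the low h bits, or d borrows from bit h, which is set since q is
  odd; the higher bits stay untouched.\<close>

lemma sigma2_diff_carry_bound:
  assumes "0 < d" "d < 2 ^ h" "r < 2 ^ h" "d \<le> r \<or> odd q"
  shows "sigma2 d + sigma2 (q * 2 ^ h + r - d) + nu2 d \<le> sigma2 (q * 2 ^ h + r) + h"
proof -
  obtain a where a: "d = Suc a" using assms(1) by (cases d) auto
  have d: "sigma2 d + nu2 d = sigma2 a + 1" using sigma2_Suc[of a] a by simp
  show ?thesis
  proof (cases "d \<le> r")
    case True
    have "sigma2 a + sigma2 (r - d) + 1 \<le> sigma2 r + h"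
      using sigma2_carry_in_bound[of a "r - d" h] True a assms(3) by simp
    moreover have "q * 2 ^ h + r - d = q * 2 ^ h + (r - d)" using True by simp
    ultimately show ?thesis
      using d assms(3) by (simp add: sigma2_mult_power2_add)
  next
    case False
    then obtain j where q: "q = Suc (2 * j)" using assms(4) by (metis oddE Suc_eq_plus1)
    have "sigma2 a + sigma2 (2 ^ h + r - d) + 1 \<le> sigma2 (1 * 2 ^ h + r) + h"
      using sigma2_carry_in_bound[of a "2 ^ h + r - d" h] a assms by simp
    moreover have "q * 2 ^ h + r - d = (2 * j) * 2 ^ h + (2 ^ h + r - d)"
      using q assms by simp
    moreover have "2 ^ h + r - d < 2 ^ h" using False assms by simp
    ultimately show ?thesis
      using d assms(3) q by (simp only: sigma2_mult_power2_add) simp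
  qed
qed

text \<open>Apply subadditivity to (s-1) + (N-s) = N-1 with \<open>N = c * 2 ^ h\<close>; as N has
  valuation h, the digit sum of N-1 is \<open>sigma2 c + h - 1\<close>.\<close>

lemma sigma2_diff_power2_ge:
  assumes "0 < s" "s \<le> c * 2 ^ h" "odd c"
  shows "sigma2 c + h \<le> sigma2 s + sigma2 (c * 2 ^ h - s) + nu2 s"
proof -
  define N where "N = c * 2 ^ h"
  obtain a where a: "s = Suc a" using assms(1) by (cases s) auto
  obtain b where b: "N = Suc b" using assms by (cases N) (auto simp: N_def)
  have "nu2 N = h"
    using assms by (simp add: N_def prime_elem_multiplicity_mult_distrib nu2_odd odd_pos)
  then have "sigma2 c + h = Suc (sigma2 b)"
    using sigma2_Suc[of b] b by (simp add: N_def flip: b)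
  moreover have "sigma2 b \<le> sigma2 a + sigma2 (N - s)"
    using sigma2_add_le[of a "N - s"] a b assms by (simp add: N_def)
  moreover have "sigma2 s + nu2 s = Suc (sigma2 a)" using sigma2_Suc[of a] a by simp
  ultimately show ?thesis by (simp add: N_def)
qed

section \<open>Weights i - nu2 (i+1) of the parts\<close>

lemma power2_nu2_le: "m > 0 \<Longrightarrow> 2 ^ nu2 m \<le> (m::nat)"
  by (intro dvd_imp_le multiplicity_dvd)

lemma three_mult_less_power2: "3 * a < 2 ^ a + (4::nat)"
proof (cases "a < 3")
  case True
  then have "a = 0 \<or> a = 1 \<or> a = 2" by auto
  then show ?thesis by auto
next
  case False
  then have "3 \<le> a" by simp
  then show ?thesis by (induction a rule: dec_induct) auto
qed

lemma power2_ge: "3 \<le> a \<Longrightarrow> 3 * a + 6 \<le> 2 * (2::nat) ^ a"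
  by (induction a rule: dec_induct) auto

lemma nu2_Suc_le: "nu2 (Suc i) \<le> i"
proof -
  have "2 ^ nu2 (Suc i) \<le> Suc i" by (rule power2_nu2_le) simp
  then show ?thesis using less_exp[of "nu2 (Suc i)"] by linarith
qed

text \<open>Parts \<open>i = 3\<close> are the cheapest ones, with \<open>i - \<nu>\<^sub>2 (i+1) = i/3\<close>; they need separate treatment below.\<close>

lemma weight_ge:
  assumes "2 \<le> i" "i \<noteq> 3"
  shows "i + 4 \<le> 3 * (i - nu2 (Suc i))"
proof -
  define a where "a = nu2 (Suc i)"
  have p: "2 ^ a dvd Suc i" unfolding a_def by (rule multiplicity_dvd)
  then obtain q where q: "Suc i = 2 ^ a * q" by (elim dvdE)
  have "3 * a + 6 \<le> 2 * Suc i"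
  proof (cases "a < 3")
    case True
    then have "a = 0 \<or> a = 1 \<or> a = 2" by auto
    \<comment> \<open>For \<open>a < 3\<close> the bound fails only at i+1 = 1, 2 or 4, all excluded
      by the hypotheses.\<close>
    moreover have "q \<ge> 2 \<or> a \<noteq> 2" using q assms by (cases "q = 0"; cases "q = 1") auto
    moreover have "q \<ge> 2 \<or> a \<noteq> 1" using q assms by auto
    ultimately show ?thesis using q assms by auto
  next
    case False
    then show ?thesis using power2_ge[of a] dvd_imp_le[OF p] by simp
  qed
  then show ?thesis using assms by (simp add: a_def[symmetric])
qed

lemma nu2_4: "nu2 4 = 2"
  using nu2_double[of 2] nu2_double[of 1] by simp

lemma sigma2_pos: "0 < m \<Longrightarrow> 0 < sigma2 m"
proof (induction m rule: less_induct)
  case (less m)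
  show ?case
  proof (cases "even m")
    case True
    then show ?thesis using less by (auto elim!: evenE)
  qed (auto elim!: oddE)
qed

text \<open>Halving i drops at most one digit 1. The exceptions 1 and 3 can occur as halves, so
  those cases are checked directly.\<close>

lemma double_sigma2_le: "i \<noteq> 1 \<Longrightarrow> i \<noteq> 3 \<Longrightarrow> 2 * sigma2 i \<le> i"
proof (induction i rule: less_induct)
  case (less i)
  obtain j where j: "i = 2 * j \<or> i = Suc (2 * j)" by (metis evenE oddE Suc_eq_plus1)
  consider "j = 0" | "j = 1" | "j = 3" | "j \<noteq> 0" "j \<noteq> 1" "j \<noteq> 3" by blast
  then show ?case
  proof cases
    case 3
    have "sigma2 3 = 2" using sigma2_Suc_double[of 1] by (simp add: numeral_eq_Suc)
    with 3 j sigma2_double[of 3] sigma2_Suc_double[of 3] show ?thesis by auto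
  next
    case 2
    then show ?thesis using j less.prems sigma2_double[of 1] by auto
  next
    case 4
    then have "2 * sigma2 j \<le> j" using less.IH[of j] j by auto
    then show ?thesis using j 4 by auto
  qed (use j less.prems in auto)
qed

text \<open>For \<open>d \<ge> 2 ^ h\<close>: a part i pays for the digit sum of
  \<open>Suc i * u\<close> and half its share of d, with a surplus of u/2 unless
  \<open>i = 3\<close>, where equality holds because 4u and u have equal digit sums.\<close>

lemma weight_sigma2_ge:
  assumes "2 \<le> i"
  shows "2 * sigma2 (Suc i * u) + u * (i - 1) + (if i = 3 then 0 else u)
    \<le> 2 * (sigma2 u + u * (i - nu2 (Suc i)))"
proof (cases "i = 3")
  case True
  have "sigma2 (Suc i * u) = sigma2 u"
    using sigma2_mult_power2[of u 2] True by (simp add: mult.commute)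
  then show ?thesis using True nu2_4 by simp
next
  case False
  define e where "e = i - nu2 (Suc i)"
  define t where "t = sigma2 (Suc i)"
  have t: "t + nu2 (Suc i) = Suc (sigma2 i)" unfolding t_def by (rule sigma2_Suc)
  have t0: "1 \<le> t" using sigma2_pos[of "Suc i"] by (simp add: t_def)
  have "i + 2 * t \<le> 2 * e + 2"
    using t double_sigma2_le[of i] assms False nu2_Suc_le[of i] by (simp add: e_def)
  then have "u * (i + 2 * t) \<le> u * (2 * e + 2)" by (rule mult_le_mono2)
  moreover have "sigma2 (Suc i * u) \<le> t * sigma2 u" unfolding t_def by (rule sigma2_mult_le)
  \<comment> \<open>This is \<open>(t - 1) * (u - sigma2 u) \<ge> 0\<close>.\<close>
  moreover have "t * sigma2 u + u \<le> sigma2 u + t * u"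
  proof -
    obtain z where "t = Suc z" using t0 by (cases t) auto
    then show ?thesis using sigma2_le[of u] by simp
  qed
  moreover have "u * (i - 1) + u = u * i" using assms by (cases i) auto
  ultimately show ?thesis
    using False by (simp add: e_def[symmetric] distrib_left mult.commute mult.left_commute)
qed

section \<open>Valuations of the terms\<close>

text \<open>If a part other than 3 occurs, the total weight is at least (s+4)/3 for the sum s on the
  left, which exceeds \<open>nu2 s\<close> by 3a < 2^a + 4. With threes only, the claim is
  \<open>nu2 (u 3) < u 3\<close>.\<close>

lemma nu2_less_weight:
  assumes "finite I" "\<And>i. i \<in> I \<Longrightarrow> 2 \<le> i" "i0 \<in> I" "0 < u i0"
  shows "nu2 (\<Sum>i\<in>I. i * u i) < (\<Sum>i\<in>I. u i * (i - nu2 (Suc i)))"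
proof (cases "\<exists>i\<in>I. i \<noteq> 3 \<and> 0 < u i")
  case True
  then obtain j where j: "j \<in> I" "j \<noteq> 3" "0 < u j" by blast
  define s where "s = (\<Sum>i\<in>I. i * u i)"
  have "(\<Sum>i\<in>I. i * u i) + 4 \<le> (\<Sum>i\<in>I. 3 * (u i * (i - nu2 (Suc i))))"
  proof -
    have le: "i * u i \<le> 3 * (u i * (i - nu2 (Suc i)))" if "i \<in> I" for i
    proof (cases "i = 3")
      case False
      then have "u i * (i + 4) \<le> u i * (3 * (i - nu2 (Suc i)))"
        using weight_ge assms(2) that by (intro mult_le_mono2) auto
      then show ?thesis by (simp add: algebra_simps)
    qed (simp add: nu2_4)
    have "u j * (j + 4) \<le> u j * (3 * (j - nu2 (Suc j)))"
      using weight_ge assms(2) j by (intro mult_le_mono2) auto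
    moreover have "j * u j + 4 \<le> u j * (j + 4)" using j by (cases "u j") auto
    ultimately have "j * u j + 4 \<le> 3 * (u j * (j - nu2 (Suc j)))"
      by (metis le_trans mult.left_commute)
    moreover have "(\<Sum>i\<in>I - {j}. i * u i) \<le> (\<Sum>i\<in>I - {j}. 3 * (u i * (i - nu2 (Suc i))))"
      by (intro sum_mono le) auto
    ultimately show ?thesis
      using j assms(1) by (simp add: sum.remove[of I j])
  qed
  then have "s + 4 \<le> 3 * (\<Sum>i\<in>I. u i * (i - nu2 (Suc i)))"
    by (simp add: s_def sum_distrib_left)
  moreover have "0 < s"
    unfolding s_def using j assms(1,2) by (force intro!: sum_pos2[of I j])
  then have "3 * nu2 s < s + 4"
    using three_mult_less_power2[of "nu2 s"] power2_nu2_le[of s] by simp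
  ultimately show ?thesis by (simp add: s_def)
next
  case False
  then have u0: "u i = 0" if "i \<in> I" "i \<noteq> 3" for i using that by auto
  then have "i0 = 3" using assms(3,4) by (metis less_irrefl)
  then have "3 \<in> I" "0 < u 3" using assms by auto
  moreover have "(\<Sum>i\<in>I. f i) = f 3" if "\<And>i. i \<in> I \<Longrightarrow> i \<noteq> 3 \<Longrightarrow> f i = 0" for f :: "nat \<Rightarrow> nat"
    using sum.mono_neutral_right[of I "{3}" f] assms(1) \<open>3 \<in> I\<close> that by auto
  moreover have "nu2 (3 * u 3) = nu2 (u 3)"
    using \<open>0 < u 3\<close> by (simp add: prime_elem_multiplicity_mult_distrib nu2_odd)
  moreover have "nu2 (u 3) < u 3"
    using power2_nu2_le[of "u 3"] less_exp[of "nu2 (u 3)"] \<open>0 < u 3\<close> by linarith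
  ultimately show ?thesis using u0 by (simp add: nu2_4)
qed

text \<open>
  \<open>\<delta>\<close> is the borrow out of the low \<open>h\<close> bits when 1 is subtracted from \<open>c2\<^sup>h + L\<close>: it is 1 for \<open>L = 0\<close> only.
\<close>

lemma odd_mult_power2_shift:
  assumes "odd c" "Suc K = c * 2 ^ h + L" "L < 2 ^ h"
  obtains \<delta> r where "r < 2 ^ h" "\<delta> = 0 \<or> \<delta> = 1 \<and> r = 2 ^ h - 1"
    "sigma2 K = sigma2 c - \<delta> + sigma2 r" "\<delta> \<le> sigma2 c"
    "K + 2 * (c * 2 ^ h) = (3 * c - \<delta>) * 2 ^ h + r"
    "sigma2 (3 * c - \<delta>) = sigma2 (3 * c) - \<delta>" "\<delta> \<le> sigma2 (3 * c)"
proof (cases L)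
  case 0
  obtain j where j: "c = Suc (2 * j)" using assms(1) by (metis oddE Suc_eq_plus1)
  have 3: "3 * c = Suc (2 * Suc (3 * j))" using j by simp
  have K: "K = (c - 1) * 2 ^ h + (2 ^ h - 1)" using assms 0 j by simp
  show thesis
  proof (rule that[of "2 ^ h - 1" 1])
    show "sigma2 K = sigma2 c - 1 + sigma2 (2 ^ h - 1)"
      unfolding K by (subst sigma2_mult_power2_add) (simp_all add: j)
    show "K + 2 * (c * 2 ^ h) = (3 * c - 1) * 2 ^ h + (2 ^ h - 1)"
      unfolding K by (simp add: j algebra_simps)
    show "sigma2 (3 * c - 1) = sigma2 (3 * c) - 1" "1 \<le> sigma2 (3 * c)"
      unfolding 3 by (simp_all del: mult_Suc_right)
    show "1 \<le> sigma2 c" by (simp add: j)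
  qed auto
next
  case (Suc r)
  have K: "K = c * 2 ^ h + r" using assms Suc by simp
  show thesis
    by (rule that[of r 0]) (use assms Suc in \<open>auto simp: K sigma2_mult_power2_add\<close>)
qed

text \<open>The term of the partition into ones has valuation v for every L: the low bits r and the
  borrow enter both digit sums alike and cancel.\<close>

lemma leading_term_sigma2:
  assumes "odd c" "Suc K = c * 2 ^ h + L" "L < 2 ^ h" "v + sigma2 (3 * c) = 2 * sigma2 c"
  shows "v + sigma2 (K + 2 * (c * 2 ^ h)) = sigma2 K + sigma2 c"
  using assms(1-3)
proof (rule odd_mult_power2_shift)
  fix \<delta> r
  assume *: "r < 2 ^ h" "sigma2 K = sigma2 c - \<delta> + sigma2 r" "\<delta> \<le> sigma2 c"
    "K + 2 * (c * 2 ^ h) = (3 * c - \<delta>) * 2 ^ h + r"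
    "sigma2 (3 * c - \<delta>) = sigma2 (3 * c) - \<delta>" "\<delta> \<le> sigma2 (3 * c)"
  show ?thesis
    unfolding *(4) sigma2_mult_power2_add[OF *(1)] using * assms(4) by simp
qed

text \<open>Here \<open>x\<close> is the number of parts equal to 1, and \<open>I\<close> carries the parts of size at least 2.\<close>

lemma other_terms_sigma2:
  fixes u :: "nat \<Rightarrow> nat"
  assumes c: "odd c" and K: "Suc K = c * 2 ^ h + L" and L: "L < 2 ^ h"
    and v: "v + sigma2 (3 * c) = 2 * sigma2 c" and h: "2 * v \<le> 2 ^ h"
    and I: "finite I" "\<And>i. i \<in> I \<Longrightarrow> 2 \<le> i"
    and N: "x + (\<Sum>i\<in>I. i * u i) = c * 2 ^ h"
    and i0: "i0 \<in> I" "0 < u i0"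
  shows "v + sigma2 (K + c * 2 ^ h + x + sum u I)
    < sigma2 K + sigma2 x + (\<Sum>i\<in>I. sigma2 (u i) + u i * (i - nu2 (Suc i)))"
proof -
  define s where "s = (\<Sum>i\<in>I. i * u i)"
  define d where "d = (\<Sum>i\<in>I. u i * (i - 1))"
  define e where "e = (\<Sum>i\<in>I. u i * (i - nu2 (Suc i)))"
  define P where "P = (\<Sum>i\<in>I. sigma2 (u i))"
  have sd: "s = d + sum u I"
    unfolding s_def d_def sum.distrib[symmetric]
  proof (rule sum.cong[OF refl])
    fix i assume "i \<in> I"
    then obtain j where "i = Suc j" using I(2)[of i] by (cases i) auto
    then show "i * u i = u i * (i - 1) + u i" by simp
  qed
  have xs: "x + s = c * 2 ^ h" using N by (simp add: s_def)
  have d0: "0 < d" unfolding d_def using i0 I by (force intro!: sum_pos2[of I i0])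
  have goal_eq: "(\<Sum>i\<in>I. sigma2 (u i) + u i * (i - nu2 (Suc i))) = P + e"
    by (simp add: sum.distrib P_def e_def)
  have "v + sigma2 (K + c * 2 ^ h + x + sum u I) < sigma2 K + sigma2 x + (P + e)"
  proof (cases "d < 2 ^ h")
    case True
    \<comment> \<open>Chaining this with the next three bounds cancels h, \<open>sigma2 c\<close>
      and \<open>sigma2 d\<close>; the strictness comes from here.\<close>
    have nu: "nu2 s < e" unfolding s_def e_def by (rule nu2_less_weight[of I i0 u]) (use I i0 in auto)
    have "sigma2 s \<le> sigma2 d + P"
      unfolding sd P_def using sigma2_add_le[of d "sum u I"] sigma2_sum_le[of u I] by linarith
    moreover have "sigma2 c + h \<le> sigma2 s + sigma2 x + nu2 s"
    proof -
      have "0 < s" "s \<le> c * 2 ^ h" "c * 2 ^ h - s = x" using sd d0 xs by simp_all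
      then show ?thesis using sigma2_diff_power2_ge[of s c h] c by simp
    qed
    moreover have "v + sigma2 (K + c * 2 ^ h + x + sum u I) + sigma2 d + nu2 d \<le> sigma2 K + sigma2 c + h"
      using c K L
    proof (rule odd_mult_power2_shift)
      fix \<delta> r
      assume *: "r < 2 ^ h" "\<delta> = 0 \<or> \<delta> = 1 \<and> r = 2 ^ h - 1"
        "K + 2 * (c * 2 ^ h) = (3 * c - \<delta>) * 2 ^ h + r"
      \<comment> \<open>Without a borrow 3c is odd; with one, the low bits are all ones, so d fits
        below r.\<close>
      have "d \<le> r \<or> odd (3 * c - \<delta>)" using *(2) True c by auto
      from sigma2_diff_carry_bound[OF d0 True *(1) this]
      have "sigma2 d + sigma2 (K + 2 * (c * 2 ^ h) - d) + nu2 d \<le> sigma2 (K + 2 * (c * 2 ^ h)) + h"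
        by (simp only: *(3))
      moreover have "K + 2 * (c * 2 ^ h) - d = K + c * 2 ^ h + x + sum u I"
        using xs sd by simp
      ultimately show ?thesis
        using leading_term_sigma2[OF c K L v] by simp
    qed
    ultimately show ?thesis using nu by linarith
  next
    case False
    \<comment> \<open>The argument of the digit sum is K + 2x plus the sum of (i+1)u_i, so its digit
      sum is at most \<open>sigma2 K + sigma2 x + Q\<close>. The weights exceed Q by at least
      (d+R)/2, which is at least v.\<close>
    define Q where "Q = (\<Sum>i\<in>I. sigma2 (Suc i * u i))"
    define R where "R = (\<Sum>i\<in>I. if i = 3 then 0 else u i)"
    have ws: "s + sum u I = (\<Sum>i\<in>I. Suc i * u i)"
      by (simp add: s_def sum.distrib)
    have split: "K + c * 2 ^ h + x + sum u I = K + (2 * x + (\<Sum>i\<in>I. Suc i * u i))"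
      using xs ws by simp
    have "2 * Q + d + R \<le> 2 * (P + e)"
      unfolding Q_def d_def R_def P_def e_def sum_distrib_left sum.distrib[symmetric]
      by (rule sum_mono) (use weight_sigma2_ge I(2) in \<open>simp add: mult.commute\<close>)
    moreover have le: "sigma2 (K + c * 2 ^ h + x + sum u I) \<le> sigma2 K + sigma2 (2 * x + (\<Sum>i\<in>I. Suc i * u i))"
      unfolding split by (rule sigma2_add_le)
    moreover have "sigma2 (2 * x + (\<Sum>i\<in>I. Suc i * u i)) \<le> sigma2 x + Q"
      using sigma2_add_le[of "2 * x" "\<Sum>i\<in>I. Suc i * u i"] sigma2_sum_le[of "\<lambda>i. Suc i * u i" I]
      unfolding Q_def by simp
    \<comment> \<open>Equality would force all parts to be 1 or 3, with \<open>u\<^sub>3 = 2^(h-1)\<close>; then adding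
      \<open>2x\<close> and \<open>4u\<^sub>3\<close> produces a carry at bit \<open>h+1\<close>.\<close>
    moreover have strict: "sigma2 (2 * x + (\<Sum>i\<in>I. Suc i * u i)) < sigma2 x + Q" if "d = 2 ^ h" "R = 0"
    proof -
      have u0: "u i = 0" if "i \<in> I" "i \<noteq> 3" for i
      proof -
        have "(if i = 3 then 0 else u i) = 0"
          using \<open>R = 0\<close> I(1) \<open>i \<in> I\<close> unfolding R_def by (simp only: sum_eq_0_iff)
        then show ?thesis using \<open>i \<noteq> 3\<close> by simp
      qed
      then have "i0 = 3" using i0 by (metis less_irrefl)
      then have "3 \<in> I" using i0 by simp
      have s3: "(\<Sum>i\<in>I. f i) = f 3" if "\<And>i. i \<in> I \<Longrightarrow> i \<noteq> 3 \<Longrightarrow> f i = 0" for f :: "nat \<Rightarrow> nat"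
        using sum.mono_neutral_right[of I "{3}" f] I(1) \<open>3 \<in> I\<close> that by auto
      have d3: "u 3 * 2 = 2 ^ h" using \<open>d = 2 ^ h\<close> u0 by (simp add: d_def s3)
      then obtain g where g: "h = Suc g" by (cases h) (auto dest: arg_cong[of _ 1 even])
      have u3: "u 3 = 2 ^ g" using d3 g by simp
      have "x + 3 * 2 ^ g = 2 * c * 2 ^ g" using xs u0 u3 g by (simp add: s_def s3)
      \<comment> \<open>For \<open>c = 1\<close> the number x of ones would be negative.\<close>
      then have "c \<noteq> 1" by auto
      then obtain z where z: "c = 2 * z + 3" using c by (elim oddE) (case_tac b, auto)
      have x: "x = (4 * z + 3) * 2 ^ g"
        using \<open>x + 3 * 2 ^ g = 2 * c * 2 ^ g\<close> z by (simp add: algebra_simps)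
      have "2 * x + (\<Sum>i\<in>I. Suc i * u i) = (4 * z + 5) * 2 ^ Suc g"
        using u0 u3 by (simp add: s3 x algebra_simps)
      then have "sigma2 (2 * x + (\<Sum>i\<in>I. Suc i * u i)) = sigma2 (4 * z + 5)"
        by (simp only: sigma2_mult_power2)
      also have "4 * z + 5 = Suc (2 * (2 * Suc z))" by simp
      also have "sigma2 \<dots> = Suc (sigma2 (Suc z))" by (simp only: sigma2_Suc_double sigma2_double)
      also have "\<dots> < sigma2 (Suc (2 * Suc (2 * z))) + 1"
        using sigma2_Suc_le[of z] by (simp only: sigma2_Suc_double)
      also have "Suc (2 * Suc (2 * z)) = 4 * z + 3" by simp
      also have "sigma2 \<dots> = sigma2 x" unfolding x by (simp only: sigma2_mult_power2)
      also have "Q = 1"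
        using u0 u3 sigma2_mult_power2[of 1 "g + 2"] by (simp add: Q_def s3 power_add mult.commute)
      then have "sigma2 x + 1 = sigma2 x + Q" by simp
      finally show ?thesis .
    qed
    ultimately have *: "2 * Q + d + R \<le> 2 * (P + e)"
      "sigma2 (K + c * 2 ^ h + x + sum u I) \<le> sigma2 K + sigma2 x + Q" and
      "2 ^ h < d + R \<or> sigma2 (K + c * 2 ^ h + x + sum u I) < sigma2 K + sigma2 x + Q"
      using False by linarith+
    from this(3) show ?thesis
      by (rule disjE) (use h False * in simp)+
  qed
  then show ?thesis by (simp only: goal_eq)
qed

section \<open>Valuation of a sum with one dominant term\<close>

text \<open>Divisibility by \<open>2\<^sup>e\<close> in the ring of rationals with odd denominator.\<close>

definition dyadic_multiple :: "nat \<Rightarrow> rat \<Rightarrow> bool" where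
  "dyadic_multiple e x \<longleftrightarrow> (\<exists>a b::int. odd b \<and> x * of_int b = 2 ^ e * of_int a)"

lemma dyadic_multiple_add:
  assumes "dyadic_multiple e x" "dyadic_multiple e y"
  shows "dyadic_multiple e (x + y)"
proof -
  obtain a b where x: "odd b" "x * of_int b = 2 ^ e * of_int a"
    using assms(1) unfolding dyadic_multiple_def by blast
  obtain a' b' where y: "odd b'" "y * of_int b' = 2 ^ e * of_int a'"
    using assms(2) unfolding dyadic_multiple_def by blast
  have "(x + y) * of_int (b * b') = (x * of_int b) * of_int b' + (y * of_int b') * of_int b"
    by (simp add: algebra_simps)
  also have "\<dots> = 2 ^ e * of_int (a * b' + a' * b)" by (simp add: x y algebra_simps)
  finally show ?thesis using x y unfolding dyadic_multiple_def
    by (intro exI[of _ "a * b' + a' * b"] exI[of _ "b * b'"]) simp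
qed

lemma dyadic_multiple_0: "dyadic_multiple e 0"
  unfolding dyadic_multiple_def by (intro exI[of _ 0] exI[of _ 1]) simp

lemma dyadic_multiple_sum:
  "(\<And>i. i \<in> A \<Longrightarrow> dyadic_multiple e (f i)) \<Longrightarrow> dyadic_multiple e (\<Sum>i\<in>A. f i)"
  by (induction A rule: infinite_finite_induct) (auto intro: dyadic_multiple_add dyadic_multiple_0)

lemma nu2_decompose:
  assumes "0 < n"
  obtains m where "n = 2 ^ nu2 n * m" "odd m"
proof (rule multiplicity_decompose'[of n 2])
  show "n \<noteq> 0" using assms by simp
  show "\<not> is_unit (2::nat)" by simp
qed (rule that)

lemma dyadic_multiple_divide:
  fixes p q :: nat
  assumes "0 < q" "nu2 q + e \<le> nu2 p"
  shows "dyadic_multiple e (of_int z * (of_nat p / of_nat q))"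
proof -
  obtain q' where q': "q = 2 ^ nu2 q * q'" "odd q'"
    using nu2_decompose[OF assms(1)] .
  have "2 ^ (nu2 q + e) dvd p" using assms(2) by (rule multiplicity_dvd')
  then obtain a where a: "p = 2 ^ (nu2 q + e) * a" by (elim dvdE)
  have "of_nat p = (2 ^ nu2 q * (2 ^ e * of_nat a) :: rat)"
    by (subst a) (simp add: power_add)
  moreover have "of_nat q = (2 ^ nu2 q * of_nat q' :: rat)"
    by (subst q'(1)) simp
  moreover have "q' \<noteq> 0" using q'(2) by (metis even_zero)
  ultimately have "of_int z * (of_nat p / of_nat q) * of_nat q' = (2 ^ e * of_int (z * int a) :: rat)"
    by simp
  then show ?thesis unfolding dyadic_multiple_def using q'(2)
    by (intro exI[of _ "z * int a"] exI[of _ "int q'"]) simp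
qed

text \<open>The ultrametric principle: clearing the odd denominators gives m * odd = 2^v *
  odd.\<close>

lemma nu2_eqI:
  fixes m p q :: nat
  assumes "0 < q" "0 < p" "nu2 p = nu2 q + v"
    and "of_nat m = of_int z * (of_nat p / of_nat q) + y" "dyadic_multiple (Suc v) y" "\<bar>z\<bar> = 1"
  shows "nu2 m = v"
proof -
  obtain q' where q': "q = 2 ^ nu2 q * q'" "odd q'"
    using nu2_decompose[OF assms(1)] .
  obtain p' where p': "p = 2 ^ nu2 p * p'" "odd p'"
    using nu2_decompose[OF assms(2)] .
  obtain a b where y: "odd b" "y * of_int b = 2 ^ Suc v * of_int a"
    using assms(5) unfolding dyadic_multiple_def by blast
  have "q' \<noteq> 0" using q'(2) by (metis even_zero)
  have "of_nat p = (2 ^ nu2 q * (2 ^ v * of_nat p') :: rat)"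
    by (subst p'(1)) (simp add: assms(3) power_add)
  moreover have "of_nat q = (2 ^ nu2 q * of_nat q' :: rat)"
    by (subst q'(1)) simp
  ultimately have pq: "of_nat p / of_nat q = (2 ^ v * of_nat p' / of_nat q' :: rat)" by simp
  have "of_int (int m * (int q' * b)) = of_nat q' * (of_int z * (2 ^ v * of_nat p' / of_nat q')) * of_int b
      + of_nat q' * (y * of_int b)"
    by (simp add: assms(4) pq algebra_simps)
  also have "\<dots> = (of_int (2 ^ v * (z * int p' * b + 2 * (int q' * a))) :: rat)"
    using \<open>q' \<noteq> 0\<close> by (simp only: y(2)) (simp add: algebra_simps)
  finally have eq: "int m * (int q' * b) = 2 ^ v * (z * int p' * b + 2 * (int q' * a))"
    by (simp only: of_int_eq_iff)
  have "odd z" using assms(6) by (auto simp: abs_if split: if_splits)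
  then have o: "odd (z * int p' * b + 2 * (int q' * a))" using p'(2) y(1) by simp
  \<comment> \<open>The odd factor beside m can be cancelled from divisibility by any power of
    2.\<close>
  have co: "coprime (2 ^ k) (int q' * b)" for k :: nat using q'(2) y(1) by simp
  have dvd: "2 ^ k dvd m \<longleftrightarrow> 2 ^ k dvd 2 ^ v * (z * int p' * b + 2 * (int q' * a))" for k
    using coprime_dvd_mult_left_iff[OF co[of k], of "int m"] unfolding eq
    by (metis of_nat_dvd_iff of_nat_numeral of_nat_power)
  show ?thesis
  proof (rule multiplicity_eqI)
    show "2 ^ v dvd m" unfolding dvd by simp
    show "\<not> 2 ^ Suc v dvd m" unfolding dvd using o by simp
  qed
qed

section \<open>Assembling the valuation of the Stirling number\<close>

lemma nu2_mult: "0 < a \<Longrightarrow> 0 < b \<Longrightarrow> nu2 (a * b) = nu2 a + nu2 b"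
  by (rule prime_elem_multiplicity_mult_distrib) auto

lemma nu2_expansion_denominator:
  fixes u :: "nat \<Rightarrow> nat"
  assumes "finite I"
  shows "nu2 (fact K * (\<Prod>i\<in>I. Suc i ^ u i * fact (u i))) + sigma2 K + (\<Sum>i\<in>I. sigma2 (u i))
    = K + sum u I + (\<Sum>i\<in>I. u i * nu2 (Suc i))"
  using assms
proof (induction I rule: finite_induct)
  case empty
  then show ?case using nu2_fact[of K] by simp
next
  case (insert x I)
  have "nu2 (Suc x ^ u x * fact (u x)) = u x * nu2 (Suc x) + nu2 (fact (u x))"
    by (subst nu2_mult) (simp_all add: prime_elem_multiplicity_power_distrib)
  moreover have "nu2 (fact K * (\<Prod>i\<in>insert x I. Suc i ^ u i * fact (u i)))
      = nu2 (Suc x ^ u x * fact (u x)) + nu2 (fact K * (\<Prod>i\<in>I. Suc i ^ u i * fact (u i)))"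
    using insert.hyps
    by (subst nu2_mult[symmetric]) (auto simp: mult.left_commute intro!: prod_pos)
  ultimately show ?case
    using insert nu2_fact[of "u x"] by simp
qed

text \<open>Legendre's formula for (3c)!/(c! (2c)!), where 2c and c have equal digit sums; it links
  the bound on h to the claimed value.\<close>

lemma nu2_binomial_3c: "nu2 ((3 * c) choose c) + sigma2 (3 * c) = 2 * sigma2 c"
proof -
  have "fact (3 * c) = fact c * (fact (2 * c) * ((3 * c) choose c))"
    using binomial_fact_lemma[of c "3 * c"] by (simp add: mult.assoc)
  then have "nu2 (fact (3 * c)) = nu2 (fact c) + (nu2 (fact (2 * c)) + nu2 ((3 * c) choose c))"
    by (simp add: nu2_mult)
  then show ?thesis using nu2_fact[of c] nu2_fact[of "2 * c"] nu2_fact[of "3 * c"] by simp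
qed

proposition nu2_Stirling:
  assumes c: "odd c" and L: "L < 2 ^ h" and h: "2 * nu2 ((3 * c) choose c) \<le> 2 ^ h"
  shows "nu2 (Stirling (c * 2 ^ (h + 1) + L) (c * 2 ^ h + L)) = nu2 ((3 * c) choose c)"
proof -
  define N where "N = c * 2 ^ h"
  define v where "v = nu2 ((3 * c) choose c)"
  have N0: "0 < N" using c by (auto simp: N_def odd_pos)
  then obtain K where K: "Suc K = N + L" by (metis add_gr_0 gr0_conv_Suc)
  have v: "v + sigma2 (3 * c) = 2 * sigma2 c" unfolding v_def by (rule nu2_binomial_3c)
  define W where "W = {u. u \<in> {1..N} \<rightarrow>\<^sub>E {..N} \<and> (\<Sum>i\<in>{1..N}. i * u i) = N}"
  define num where "num u = (fact (K + N + sum u {1..N}) :: nat)" for u :: "nat \<Rightarrow> nat"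
  define den where "den u = fact K * (\<Prod>i\<in>{1..N}. Suc i ^ u i * fact (u i))" for u :: "nat \<Rightarrow> nat"
  define sg where "sg u = (\<Prod>i\<in>{1..N}. ((-1) ^ Suc i) ^ u i :: int)" for u :: "nat \<Rightarrow> nat"
  define T :: "(nat \<Rightarrow> nat) \<Rightarrow> rat" where "T u = of_int (sg u) * (of_nat (num u) / of_nat (den u))" for u
  \<comment> \<open>The partition into N ones; the value \<open>undefined\<close> outside the range
    is what membership in the extensional function space demands.\<close>
  define u0 where "u0 = (\<lambda>i. if i \<in> {1..N} then if i = 1 then N else 0 else undefined)"
  have den0: "0 < den u" for u unfolding den_def by (auto intro!: prod_pos)
  have split: "{1..N} = insert 1 {2..N}" using N0 by auto
  have u0_sums: "(\<Sum>i\<in>{1..N}. f i (u0 i)) = f 1 N" if "\<And>i. f i 0 = 0" for f :: "nat \<Rightarrow> nat \<Rightarrow> nat"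
  proof -
    have "(\<Sum>i\<in>{1..N}. f i (u0 i)) = f 1 (u0 1)"
      using N0 that by (subst sum.remove[of _ 1]) (auto simp: u0_def intro!: sum.neutral)
    then show ?thesis using N0 by (simp add: u0_def)
  qed
  have T: "fact (K + N + sum u {1..N}) / fact K
      * (\<Prod>i\<in>{1..N}. ((-1) ^ Suc i / of_nat (Suc i)) ^ u i / fact (u i)) = T u" for u
    unfolding T_def num_def den_def sg_def
    by (simp add: power_divide prod_dividef prod.distrib del: of_nat_Suc power_Suc)
  have idx: "c * 2 ^ (h + 1) + L = Suc (K + N)" "c * 2 ^ h + L = Suc K"
    using K by (simp_all add: N_def)
  have "finite W"
    by (rule finite_subset[of _ "{1..N} \<rightarrow>\<^sub>E {..N}"]) (auto simp: W_def intro!: finite_PiE)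
  moreover have "u0 \<in> W"
  proof -
    have "u0 \<in> {1..N} \<rightarrow>\<^sub>E {..N}" by (auto simp: u0_def)
    moreover have "(\<Sum>i\<in>{1..N}. i * u0 i) = N"
      using u0_sums[of "\<lambda>i x. i * x"] by simp
    ultimately show ?thesis by (simp add: W_def)
  qed
  ultimately have "(\<Sum>u\<in>W. T u) = T u0 + (\<Sum>u\<in>W - {u0}. T u)"
    by (rule sum.remove)
  then have S: "of_nat (Stirling (c * 2 ^ (h + 1) + L) (c * 2 ^ h + L)) = T u0 + (\<Sum>u\<in>W - {u0}. T u)"
    unfolding idx Stirling_expansion W_def[symmetric] T .
  have nu: "nu2 (num u) + sigma2 (K + N + sum u {1..N}) = K + N + sum u {1..N}"
    "nu2 (den u) + sigma2 K + (\<Sum>i\<in>{1..N}. sigma2 (u i)) = K + sum u {1..N} + (\<Sum>i\<in>{1..N}. u i * nu2 (Suc i))" for u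
    unfolding num_def den_def by (rule nu2_fact, rule nu2_expansion_denominator) simp
  have lead: "nu2 (num u0) = nu2 (den u0) + v"
  proof -
    have "v + sigma2 (K + 2 * N) = sigma2 K + sigma2 c"
      using leading_term_sigma2[OF c _ L v, of K] K by (simp add: N_def)
    then show ?thesis
      using nu[of u0] u0_sums[of "\<lambda>i x. x"] u0_sums[of "\<lambda>i. sigma2"] u0_sums[of "\<lambda>i x. x * nu2 (Suc i)"]
        nu2_double[of 1]
      by (simp add: N_def mult_2 add.assoc flip: numeral_2_eq_2)
  qed
  have rest: "dyadic_multiple (Suc v) (\<Sum>u\<in>W - {u0}. T u)"
  proof (rule dyadic_multiple_sum)
    fix u assume u: "u \<in> W - {u0}"
    have uN: "u 1 + (\<Sum>i\<in>{2..N}. i * u i) = N" using u unfolding W_def split by simp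
    have "\<exists>i0\<in>{2..N}. 0 < u i0"
    proof (rule ccontr)
      assume "\<not> ?thesis"
      then have z: "u i = 0" if "i \<in> {2..N}" for i using that by auto
      then have "u 1 = N" using uN by simp
      moreover have "u i = undefined" if "i \<notin> {1..N}" for i
        using u that by (auto simp: W_def PiE_def extensional_def)
      ultimately have "u = u0" using z by (auto simp: fun_eq_iff u0_def)
      then show False using u by simp
    qed
    then obtain i0 where i0: "i0 \<in> {2..N}" "0 < u i0" by blast
    have *: "v + sigma2 (K + N + u 1 + sum u {2..N})
        < sigma2 K + sigma2 (u 1) + (\<Sum>i\<in>{2..N}. sigma2 (u i) + u i * (i - nu2 (Suc i)))"
      unfolding N_def
      by (rule other_terms_sigma2[where I = "{2..c * 2 ^ h}" and L = L and ?i0.0 = i0]) (use c K L v h uN i0 in \<open>simp_all add: N_def v_def\<close>)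
    \<comment> \<open>The truncated subtraction is harmless because
      \<open>nu2 (Suc i) \<le> i\<close>.\<close>
    have "(\<Sum>i\<in>{2..N}. i * u i) = (\<Sum>i\<in>{2..N}. u i * (i - nu2 (Suc i))) + (\<Sum>i\<in>{2..N}. u i * nu2 (Suc i))"
      unfolding sum.distrib[symmetric]
      by (intro sum.cong refl) (use nu2_Suc_le in \<open>simp add: mult.commute flip: add_mult_distrib2\<close>)
    then have "nu2 (den u) + Suc v \<le> nu2 (num u)"
      using * nu[of u] uN nu2_double[of 1] unfolding split
      by (simp add: sum.distrib add.assoc flip: numeral_2_eq_2)
    then show "dyadic_multiple (Suc v) (T u)"
      unfolding T_def by (rule dyadic_multiple_divide[OF den0])
  qed
  have "0 < num u0" "\<bar>sg u0\<bar> = 1"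
    unfolding num_def sg_def by (simp_all add: abs_prod power_abs)
  from nu2_eqI[OF den0 this(1) lead S[unfolded T_def[of u0]] rest this(2)]
  show ?thesis by (simp only: v_def)
qed

theorem theorem3p3:
  fixes c :: nat
  assumes "odd c"
  shows "(\<forall>\<^sub>F h in sequentially.
            (\<exists>v. \<forall>L::nat. L < 2 ^ h \<longrightarrow> nu2 (Stirling (c * 2 ^ (h + 1) + L) (c * 2 ^ h + L)) = v) \<and>
            (\<forall>L::nat. L < 2 ^ h \<longrightarrow>
              int (nu2 (Stirling (c * 2 ^ (h + 1) + L) (c * 2 ^ h + L)))
                = 2 * int (sigma2 c) - int (sigma2 (3 * c))))
       \<and> (\<forall>h::nat. (2::real) powi (int h - 1) \<ge> real (nu2 ((3 * c) choose c)) \<longrightarrow>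
            (\<exists>v. \<forall>L::nat. L < 2 ^ h \<longrightarrow> nu2 (Stirling (c * 2 ^ (h + 1) + L) (c * 2 ^ h + L)) = v) \<and>
            (\<forall>L::nat. L < 2 ^ h \<longrightarrow>
              int (nu2 (Stirling (c * 2 ^ (h + 1) + L) (c * 2 ^ h + L)))
                = 2 * int (sigma2 c) - int (sigma2 (3 * c))))"
    (is "eventually ?P _ \<and> _")
proof -
  define v where "v = nu2 ((3 * c) choose c)"
  have v: "int v = 2 * int (sigma2 c) - int (sigma2 (3 * c))"
    using nu2_binomial_3c[of c] by (simp add: v_def)
  have P: "?P h" if "2 * v \<le> 2 ^ h" for h
  proof -
    have "nu2 (Stirling (c * 2 ^ (h + 1) + L) (c * 2 ^ h + L)) = v" if "L < 2 ^ h" for L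
      using nu2_Stirling[OF assms that] \<open>2 * v \<le> 2 ^ h\<close> by (simp only: v_def)
    then show ?thesis using v by metis
  qed
  have "2 * v \<le> 2 ^ h" if "(2::real) powi (int h - 1) \<ge> real v" for h
  proof -
    \<comment> \<open>The integer exponent makes this true also for \<open>h = 0\<close>, where the
      value is 1/2.\<close>
    have "(2::real) powi (int h - 1) = 2 ^ h / 2" by (simp add: power_int_diff)
    then have "real (2 * v) \<le> real (2 ^ h)" using that by simp
    then show ?thesis by (simp only: of_nat_le_iff)
  qed
  \<comment> \<open>Any \<open>h \<ge> 2 * v\<close> is large enough, since h < 2^h.\<close>
  moreover have "eventually ?P sequentially"
    using eventually_ge_at_top[of "2 * v"]
    by eventually_elim (rule P, use less_exp in \<open>meson le_trans less_imp_le\<close>)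
  ultimately show ?thesis using P unfolding v_def by blast
qed

end
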